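(* Let $A$ be a torsion-free, finitely generated abelian group with a finite generating subset $S$. If $B \leq A$ is a subgroup of infinite index, then $\mathrm{F}_{A,B,S}(n) \approx \log(n)$.
   Context: $\mathbb{N}=\{1,2,\dots\}$. For a group $G$ with finite generating subset $S$, $\|g\|_S$ denotes the word length of $g\in G$ with respect to $S$. For a group $G$, a proper subgroup $H$ and $g \in G\setminus H$, set $\mathrm{D}_G(H,g) = \min\{|Q| : Q \text{ is a finite group and there is a group morphism } \pi: G\to Q \text{ with } \pi(g)\notin\pi(H)\}$, with value $\infty$ if no such $Q$ exists. A finitely generated subgroup $H$ is separable in $G$ if $\mathrm{D}_G(H,g)<\infty$ for all $g\in G\setminus H$. For a proper, finitely generated, separable subgroup $H \le G$, set $\mathrm{F}_{G,H,S}(n) = \max\{\mathrm{D}_G(H,g) : g\in G\setminus H,\ \|g\|_S\le n\}$ for $n\in\mathbb{N}$. (All subgroups of finitely generated abelian groups are finitely generated and separable.) For non-decreasing functions $f,g$ on $\mathbb{N}$, $f\preceq g$ means there is $C\in\mathbb{N}$ with $f(n)\le C\,g(Cn)$ for all $n$ (also used for real-valued expressions such as $\log(n)$), and $f\approx g$ means $f\preceq g$ and $g\preceq f$. *)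

theory Defs
  imports "HOL-Algebra.Coset" "HOL-Algebra.Generated_Groups" "HOL-Library.Extended_Nat" "HOL-Library.Extended_Real"
    Complex_Main
begin

definition torsion_free_group :: "('a, 'b) monoid_scheme \<Rightarrow> bool" where
  "torsion_free_group G \<longleftrightarrow>
     (\<forall>x\<in>carrier G. \<forall>n::nat. n > 0 \<longrightarrow> x [^]\<^bsub>G\<^esub> n = \<one>\<^bsub>G\<^esub> \<longrightarrow> x = \<one>\<^bsub>G\<^esub>)"

definition finite_generating_set :: "('a, 'b) monoid_scheme \<Rightarrow> 'a set \<Rightarrow> bool" where
  "finite_generating_set G S \<longleftrightarrow> finite S \<and> S \<subseteq> carrier G \<and> generate G S = carrier G"

(* Words are in the letters S and their inverses. The value is meaningful only for elements
   of the subgroup generated by S. *)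
definition word_length :: "('a, 'b) monoid_scheme \<Rightarrow> 'a set \<Rightarrow> 'a \<Rightarrow> nat" where
  "word_length G S g =
     (LEAST n. \<exists>w. set w \<subseteq> S \<union> m_inv G ` S \<and> length w = n \<and> foldr (\<otimes>\<^bsub>G\<^esub>) w \<one>\<^bsub>G\<^esub> = g)"

(* The infimum in enat is attained when the set is nonempty, and is infinite otherwise.
   The finite groups range over those carried by sets of naturals, which loses nothing as every
   finite group has an isomorphic copy of this form; see sep_depth_le. *)
definition sep_depth :: "('a, 'b) monoid_scheme \<Rightarrow> 'a set \<Rightarrow> 'a \<Rightarrow> enat" where
  "sep_depth G H g =
     (INF Q \<in> {Q :: nat monoid. group Q \<and> finite (carrier Q) \<and> (\<exists>\<pi> \<in> hom G Q. \<pi> g \<notin> \<pi> ` H)}.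
        enat (order Q))"

(* When S is a finite generating set, H is proper and n > 0, the supremum is over a finite
   nonempty set and hence a maximum. Keeping the value in enat makes the function total: it takes
   the value infinity when some g outside H within the ball cannot be separated from H. *)
definition sep_growth :: "('a, 'b) monoid_scheme \<Rightarrow> 'a set \<Rightarrow> 'a set \<Rightarrow> nat \<Rightarrow> enat" where
  "sep_growth G H S n =
     (SUP g \<in> {g \<in> carrier G - H. word_length G S g \<le> n}. sep_depth G H g)"

(* Functions on the positive integers, hence the restriction to n > 0. Values are extended reals so
   as to accommodate both sep_growth and real-valued functions; as C > 0, a function with an
   infinite value is never dominated by a real-valued one. *)
definition growth_le :: "(nat \<Rightarrow> ereal) \<Rightarrow> (nat \<Rightarrow> ereal) \<Rightarrow> bool" (infix "\<lesssim>g" 50) where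
  "f \<lesssim>g h \<longleftrightarrow> (\<exists>C::nat. C > 0 \<and> (\<forall>n>0. f n \<le> ereal (real C) * h (C * n)))"

definition growth_equiv :: "(nat \<Rightarrow> ereal) \<Rightarrow> (nat \<Rightarrow> ereal) \<Rightarrow> bool" (infix "\<approx>g" 50) where
  "f \<approx>g h \<longleftrightarrow> f \<lesssim>g h \<and> h \<lesssim>g f"

lemma sep_depth_le:
  fixes G :: "('a, 'b) monoid_scheme" and Q :: "('q, 'r) monoid_scheme"
  assumes Q: "group Q" "finite (carrier Q)" and p: "p \<in> hom G Q" "p g \<notin> p ` H"
    and H: "H \<subseteq> carrier G" "g \<in> carrier G"
  shows "sep_depth G H g \<le> enat (order Q)"
proof -
  interpret Q: group Q by fact
  obtain f :: "'q \<Rightarrow> nat" where f: "inj_on f (carrier Q)"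
    using finite_imp_inj_to_nat_seg[OF Q(2)] by blast
  define k where "k = inv_into (carrier Q) f"
  define R :: "nat monoid" where
    "R = \<lparr>carrier = f ` carrier Q, monoid.mult = (\<lambda>a b. f (k a \<otimes>\<^bsub>Q\<^esub> k b)), one = f \<one>\<^bsub>Q\<^esub>\<rparr>"
  have k: "k (f x) = x" if "x \<in> carrier Q" for x
    unfolding k_def using f that by (rule inv_into_f_f)
  have R: "carrier R = f ` carrier Q" "\<one>\<^bsub>R\<^esub> = f \<one>\<^bsub>Q\<^esub>"
    "\<And>a b. a \<otimes>\<^bsub>R\<^esub> b = f (k a \<otimes>\<^bsub>Q\<^esub> k b)" by (simp_all add: R_def)
  have "group R"
  proof (rule groupI)
    fix x assume "x \<in> carrier R"
    then obtain y where y: "y \<in> carrier Q" "x = f y" by (auto simp: R)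
    then show "\<exists>z\<in>carrier R. z \<otimes>\<^bsub>R\<^esub> x = \<one>\<^bsub>R\<^esub>"
      by (intro bexI[of _ "f (inv\<^bsub>Q\<^esub> y)"]) (auto simp: R k)
  qed (auto simp: R k Q.m_assoc)
  moreover have "finite (carrier R)" using Q(2) by (simp add: R)
  moreover have "f \<circ> p \<in> hom G R"
    using p(1) by (auto simp: hom_def R k Pi_iff)
  moreover have "(f \<circ> p) g \<notin> (f \<circ> p) ` H"
  proof
    assume "(f \<circ> p) g \<in> (f \<circ> p) ` H"
    then obtain h where h: "h \<in> H" "f (p g) = f (p h)" by auto
    have "p g \<in> carrier Q" "p h \<in> carrier Q" using p(1) H h(1) by (auto simp: hom_def)
    then have "p g = p h" using h(2) f by (simp add: inj_on_def)
    then show False using p(2) h(1) by blast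
  qed
  ultimately have "sep_depth G H g \<le> enat (order R)"
    unfolding sep_depth_def by (intro INF_lower) blast
  also have "order R = order Q" using f by (simp add: order_def R card_image)
  finally show ?thesis .
qed

end

theory Submission
  imports Defs "HOL-Computational_Algebra.Primes" "HOL-Algebra.Elementary_Groups"
    "HOL-Algebra.Multiplicative_Group"
begin

text \<open>
  Separating g from B amounts to finding a small finite quotient of the quotient group A/B in which
  the image of g survives. Both directions reduce this to the divisibility of integers, and both
  rest on the fact that the least common multiple of 1, ..., m grows exponentially in m
  (\<open>Lcm_lower_bound\<close> and \<open>Lcm_upper_bound\<close>).

  Upper bound. Finitely many homomorphisms from A to the integers that vanish on B detect all
  elements of A/B except torsion of bounded exponent (\<open>exists_integer_homs\<close>). If one of them takes a
  nonzero value k at g, then k is bounded linearly by the length of g (\<open>integer_hom_le_word_length\<close>).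
  An integer divisible by all numbers up to m is divisible by their least common multiple, so k has a
  nondivisor q of size logarithmic in the length of g (\<open>small_nondivisor\<close>), and the cyclic group of
  order q separates g from B. The elements at which all these homomorphisms vanish are separated by
  one fixed finite quotient (\<open>sep_depth_power_coset\<close>). Together this is \<open>sep_depth_upper_bound\<close>.

  Lower bound. Since B has infinite index, some generator s has no positive power in B
  (\<open>infinite_order_generator\<close>). The power of s with exponent \<open>Lcm {1..m}\<close> is killed in every group
  of order at most m (\<open>sep_depth_lcm_power\<close>), although its length is at most \<open>16 ^ m\<close>. Hence elements
  of length at most n require quotients of order at least a constant times \<open>ln n\<close>.
\<close>

section \<open>Least common multiples of initial segments\<close>

text \<open>
  The lower bound for least common multiples comes from Leibniz's harmonic triangle, whose entries are
  the reciprocals of the numbers \<open>k * (k + r choose k)\<close>. Each entry is the difference of an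
  entry of the preceding row and an adjacent entry of its own row, so if L times every element of the
  edge \<open>1/k, ..., 1/(k + r)\<close> is an integer, then so is L times every entry that they determine.
\<close>

lemma binomial_dvd_of_consecutive_dvd:
  fixes L :: int
  assumes "0 < k" "\<And>j. k \<le> j \<Longrightarrow> j \<le> k + r \<Longrightarrow> int j dvd L"
  shows "int (k * (k + r choose k)) dvd L"
  using assms
proof (induction r arbitrary: k)
  case 0
  then show ?case by simp
next
  case (Suc r)
  define a where "a = int (k * (k + r choose k))"
  define b where "b = int (Suc k * (Suc k + r choose Suc k))"
  define c where "c = int (k * (k + Suc r choose k))"
  have "a dvd L" unfolding a_def by (rule Suc.IH) (use Suc.prems in auto)
  then obtain u where u: "L = a * u" by blast
  have "b dvd L" unfolding b_def by (rule Suc.IH) (use Suc.prems in auto)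
  then obtain v where v: "L = b * v" by blast
  \<comment> \<open>With u = L / a and v = L / b, the two relations below say that 1 / c = 1 / a - 1 / b.\<close>
  have kb: "int k * b = int (k + r + 1) * a"
    unfolding a_def b_def using Suc_times_binomial[of k "k + r"]
    by (simp del: mult_Suc binomial_Suc_Suc of_nat_Suc flip: of_nat_mult)
  have "Suc r * (k + Suc r choose k) = (k + Suc r) * (k + r choose k)"
    using binomial_absorb_comp[of "k + Suc r" k] by simp
  then have rc: "int (Suc r) * c = int (k + r + 1) * a"
    unfolding a_def c_def by (simp del: of_nat_Suc mult_Suc flip: of_nat_mult)
  have "int (Suc r) * (c * (u - v)) = int (k + r + 1) * (a * u) - int k * (b * v)"
    using kb rc by (metis mult.assoc right_diff_distrib)
  also have "\<dots> = int (Suc r) * L"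
    unfolding u[symmetric] v[symmetric] by (simp add: algebra_simps)
  finally have "L = c * (u - v)" by simp
  then show ?case unfolding c_def by simp
qed

lemma Lcm_atLeastAtMost_pos: "0 < Lcm {1..n::nat}"
  by (auto simp: Lcm_0_iff_nat intro!: Nat.gr0I)

text \<open>
  The least common multiple bounds every \<open>k * (n choose k)\<close>, and these n numbers average to
  \<open>2 ^ (n - 1)\<close>.
\<close>

lemma Lcm_lower_bound:
  assumes "0 < n"
  shows "2 ^ (n - 1) \<le> Lcm {1..n::nat}"
proof -
  let ?L = "Lcm {1..n}"
  have pos: "0 < ?L" by (rule Lcm_atLeastAtMost_pos)
  have le: "k * (n choose k) \<le> ?L" if "k \<le> n" for k
  proof (cases "k = 0")
    case False
    have "int (k * (k + (n - k) choose k)) dvd int ?L"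
      by (rule binomial_dvd_of_consecutive_dvd) (use False that in auto)
    then show ?thesis using that pos by (auto simp: int_dvd_int_iff simp del: of_nat_mult intro: dvd_imp_le)
  qed simp
  have "n * 2 ^ (n - 1) = (\<Sum>k\<le>n. k * (n choose k))" by (simp add: choose_linear_sum)
  also have "\<dots> = (\<Sum>k=1..n. k * (n choose k))"
    by (rule sum.mono_neutral_right) (auto simp: Suc_le_eq)
  also have "\<dots> \<le> (\<Sum>k=1..n. ?L)" using le by (intro sum_mono) auto
  also have "\<dots> = n * ?L" by simp
  finally show ?thesis using assms by simp
qed

text \<open>
  A nonzero integer divisible by everything up to \<open>Suc m\<close> is divisible by their least common
  multiple and hence is too large.
\<close>

lemma small_nondivisor:
  fixes k :: int
  assumes "k \<noteq> 0" "\<bar>k\<bar> < 2 ^ m"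
  obtains q where "0 < q" "q \<le> Suc m" "\<not> int q dvd k"
proof -
  have "\<exists>q\<in>{1..Suc m}. \<not> int q dvd k"
  proof (rule ccontr)
    assume "\<not> ?thesis"
    then have "Lcm {1..Suc m} dvd nat \<bar>k\<bar>" by (intro Lcm_least) (auto simp: dvd_nat_abs_iff)
    then have "Lcm {1..Suc m} \<le> nat \<bar>k\<bar>" using assms(1) by (intro dvd_imp_le) auto
    moreover have "2 ^ m \<le> Lcm {1..Suc m}" using Lcm_lower_bound[of "Suc m"] by simp
    ultimately have "2 ^ m \<le> nat \<bar>k\<bar>" by linarith
    then have "int (2 ^ m) \<le> \<bar>k\<bar>" by linarith
    then show False using assms(2) by simp
  qed
  then obtain q where "q \<in> {1..Suc m}" "\<not> int q dvd k" by (elim bexE)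
  then show thesis by (intro that[of q]) simp_all
qed

lemma prime_dvd_prime_power_choose:
  assumes "prime (p::nat)" "0 < i" "i < p ^ e"
  shows "p dvd (p ^ e choose i)"
proof (rule ccontr)
  assume "\<not> ?thesis"
  then have "coprime (p ^ e) (p ^ e choose i)"
    using assms(1) by (simp add: prime_imp_coprime)
  moreover have "p ^ e dvd i * (p ^ e choose i)"
    using assms(2) by (simp add: times_binomial_minus1_eq)
  ultimately have "p ^ e dvd i" by (simp add: coprime_dvd_mult_left_iff)
  then show False using assms(2,3) dvd_imp_le by fastforce
qed

text \<open>
  Modulo p the binomial theorem gives \<open>(1 + X)^(2 m) = (1 + X^q) (1 + X)^(2 m - q)\<close> with
  \<open>q = p ^ e\<close>. As q exceeds m and the second factor has degree below m, no term of degree m occurs.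
  Vandermonde's identity is this computation on the level of coefficients.
\<close>

lemma prime_dvd_central_binomial:
  assumes "prime (p::nat)" "m < p ^ e" "p ^ e \<le> 2 * m"
  shows "p dvd (2 * m choose m)"
proof -
  have "(2 * m choose m) = (\<Sum>i\<le>m. (p ^ e choose i) * (2 * m - p ^ e choose (m - i)))"
    using vandermonde[of "p ^ e" "2 * m - p ^ e" m] assms(3) by simp
  also have "p dvd \<dots>"
  proof (rule dvd_sum)
    fix i assume "i \<in> {..m}"
    then show "p dvd (p ^ e choose i) * (2 * m - p ^ e choose (m - i))"
      using assms prime_dvd_prime_power_choose[of p i e] by (cases "i = 0") (auto simp: binomial_eq_0)
  qed
  finally show ?thesis .
qed

text \<open>
  Passing from m to \<open>2 * m\<close> increases the exponent of a prime p in the least common multiple by at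
  most one, and only if some power of p lies between m and \<open>2 * m\<close>. In that case p divides the
  central binomial coefficient. It is Chebyshev's upper estimate in multiplicative form.
\<close>

lemma Lcm_double_dvd: "Lcm {1..2 * m} dvd (2 * m choose m) * Lcm {1..m::nat}"
proof (rule Lcm_least)
  fix j assume j: "j \<in> {1..2 * m}"
  let ?R = "(2 * m choose m) * Lcm {1..m}"
  have R: "?R \<noteq> 0" using Lcm_atLeastAtMost_pos[of m] by simp
  show "j dvd ?R"
  proof (rule multiplicity_le_imp_dvd)
    show "j \<noteq> 0" using j by simp
  next
    fix p :: nat assume p: "prime p"
    define e where "e = multiplicity p j"
    have "p ^ e dvd j" unfolding e_def by (rule multiplicity_dvd)
    then have le: "p ^ e \<le> 2 * m" using j by (auto dest!: dvd_imp_le)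
    have "p ^ e dvd ?R"
    proof (cases "p ^ e \<le> m")
      case True
      then have "p ^ e dvd Lcm {1..m}" using p by (intro dvd_Lcm) (auto simp: Suc_le_eq prime_gt_0_nat)
      then show ?thesis by simp
    next
      case False
      with j obtain d where e: "e = Suc d" by (cases e) auto
      have "p ^ d * 2 \<le> p ^ d * p" using p prime_ge_2_nat by (intro mult_left_mono) auto
      moreover have "p ^ d * p \<le> 2 * m" using le unfolding e by (simp add: mult.commute)
      ultimately have "p ^ d \<le> m" by linarith
      then have "p ^ d dvd Lcm {1..m}" using p by (intro dvd_Lcm) (auto simp: Suc_le_eq prime_gt_0_nat)
      moreover have "p dvd (2 * m choose m)"
        using prime_dvd_central_binomial[OF p _ le] False by simp
      ultimately show ?thesis unfolding e power_Suc by (rule mult_dvd_mono[rotated])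
    qed
    then show "multiplicity p j \<le> multiplicity p ?R"
      unfolding e_def[symmetric] using p R by (intro multiplicity_geI) auto
  qed
qed

text \<open>
  Iterating the doubling step costs \<open>4 ^ m\<close> at each stage, a geometric progression in the exponent;
  the base 16 instead of 4 leaves room for rounding \<open>n / 2\<close> up.
\<close>

lemma Lcm_upper_bound: "Lcm {1..n::nat} \<le> 16 ^ n"
proof (induction n rule: less_induct)
  case (less n)
  show ?case
  proof (cases "n \<le> 1")
    case True
    then show ?thesis by (cases n) auto
  next
    case False
    define m where "m = (n + 1) div 2"
    have m: "m < n" "n \<le> 2 * m" "2 * m \<le> n + 1" using False unfolding m_def by auto
    have "Lcm {1..n} dvd Lcm {1..2 * m}" using m by (intro Lcm_subset) auto
    also note Lcm_double_dvd
    finally have "Lcm {1..n} \<le> (2 * m choose m) * Lcm {1..m}"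
      by (rule dvd_imp_le) (use Lcm_atLeastAtMost_pos[of m] in simp)
    also have "\<dots> \<le> 2 ^ (2 * m) * 16 ^ m"
      using less[OF m(1)] by (intro mult_mono binomial_le_pow2) auto
    also have "\<dots> = 2 ^ (6 * m)" by (simp add: power_mult power_mult_distrib[symmetric])
    also have "\<dots> \<le> 2 ^ (4 * n)"
    proof (rule power_increasing)
      show "6 * m \<le> 4 * n" using m False by (cases "n = 2") linarith+
    qed simp
    also have "\<dots> = 16 ^ n" by (simp add: power_mult)
    finally show ?thesis .
  qed
qed

section \<open>Finitely generated abelian groups modulo a subgroup\<close>

context comm_group
begin

lemma generate_insert_decompose:
  assumes X: "X \<subseteq> carrier G" and s: "s \<in> carrier G" and x: "x \<in> generate G (insert s X)"
  obtains h k where "h \<in> generate G X" "x = h \<otimes> s [^] (k::int)"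
proof -
  have "\<exists>h\<in>generate G X. \<exists>k::int. x = h \<otimes> s [^] k"
    using x
  proof (induction rule: generate.induct)
    case one
    then show ?case by (intro bexI[of _ \<one>] exI[of _ 0]) (auto intro: generate.one)
  next
    case (incl y)
    show ?case
    proof (cases "y = s")
      case True
      then show ?thesis using s by (intro bexI[of _ \<one>] exI[of _ 1]) (auto intro: generate.one)
    next
      case False
      then show ?thesis using incl X by (intro bexI[of _ y] exI[of _ 0]) (auto intro: generate.incl)
    qed
  next
    case (inv y)
    show ?case
    proof (cases "y = s")
      case True
      then show ?thesis using s
        by (intro bexI[of _ \<one>] exI[of _ "-1"]) (auto intro: generate.one simp: int_pow_neg)
    next
      case False
      then show ?thesis using inv X
        by (intro bexI[of _ "inv y"] exI[of _ 0]) (auto intro: generate.inv)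
    qed
  next
    case (eng x y)
    then obtain h k h' k' where *: "h \<in> generate G X" "x = h \<otimes> s [^] (k::int)"
      "h' \<in> generate G X" "y = h' \<otimes> s [^] (k'::int)" by blast
    have "h \<in> carrier G" "h' \<in> carrier G" using * generate_in_carrier[OF X] by auto
    then have "x \<otimes> y = (h \<otimes> h') \<otimes> s [^] (k + k')"
      using * s by (simp add: int_pow_mult m_ac)
    then show ?case using * by (blast intro: generate.eng)
  qed
  then show thesis using that by blast
qed

text \<open>
  Modulo K, each generator contributes only its first N powers. Adjoining one generator s at a time,
  every new coset is an old one translated by some \<open>s ^ j\<close> with \<open>j < N\<close>.
\<close>

lemma finite_rcosets_if_torsion_generators:
  assumes K: "subgroup K G" and "finite T" "T \<subseteq> carrier G"
    and N: "0 < (N::nat)" and "\<And>s. s \<in> T \<Longrightarrow> s [^] N \<in> K"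
  shows "finite ((#>) K ` generate G (K \<union> T))"
  using assms(2,3,5)
proof (induction T rule: finite_induct)
  case empty
  have "generate G K = K" using K generateI[of K K] by blast
  moreover have "K #> x = K" if "x \<in> K" for x
    using K that by (metis coset_join2 subgroup.mem_carrier)
  ultimately have "(#>) K ` generate G (K \<union> {}) \<subseteq> {K}" by auto
  then show ?case by (rule finite_subset) simp
next
  case (insert s T)
  have Kc: "K \<subseteq> carrier G" using K by (rule subgroup.subset)
  have X: "K \<union> T \<subseteq> carrier G" and s: "s \<in> carrier G" using insert.prems Kc by auto
  have "(#>) K ` generate G (K \<union> insert s T) \<subseteq>
    (\<Union>j<N. (\<lambda>C. C #> s [^] j) ` ((#>) K ` generate G (K \<union> T)))"
  proof (rule image_subsetI)
    fix x assume "x \<in> generate G (K \<union> insert s T)"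
    then obtain h k where h: "h \<in> generate G (K \<union> T)" and x: "x = h \<otimes> s [^] (k::int)"
      using generate_insert_decompose[OF X s] by auto
    have hc: "h \<in> carrier G" using generate_in_carrier[OF X h] .
    define j where "j = nat (k mod int N)"
    have j: "j < N" "int j = k mod int N" using N by (auto simp: j_def nat_less_iff)
    have "k = int N * (k div int N) + int j" by (simp add: j)
    then have "s [^] k = (s [^] N) [^] (k div int N) \<otimes> s [^] j"
      using s by (metis int_pow_closed int_pow_int int_pow_mult int_pow_pow)
    moreover have "(s [^] N) [^] (k div int N) \<in> K"
      using insert.prems(2)[of s] by (intro subgroup_int_pow_closed[OF K]) auto
    ultimately obtain y where y: "y \<in> K" "s [^] k = y \<otimes> s [^] j" by blast
    have "x = y \<otimes> (h \<otimes> s [^] j)" using x y hc s Kc by (auto simp: m_ac subset_iff)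
    then have "K #> x = K #> (h \<otimes> s [^] j)"
      using y hc s Kc coset_mult_assoc[of K y "h \<otimes> s [^] j"] coset_join2[of y K] K
      by (auto simp: subset_iff)
    also have "\<dots> = K #> h #> s [^] j" using hc s Kc by (simp add: coset_mult_assoc)
    finally show "K #> x \<in> (\<Union>j<N. (\<lambda>C. C #> s [^] j) ` ((#>) K ` generate G (K \<union> T)))"
      using j(1) h by blast
  qed
  moreover have "finite ((#>) K ` generate G (K \<union> T))" using insert by auto
  ultimately show ?case by (meson finite_UN_I finite_imageI finite_lessThan finite_subset)
qed

text \<open>
  This is the part of the structure theorem for finitely generated abelian groups that separation
  needs: modulo B, finitely many integer-valued homomorphisms detect everything except torsion of
  bounded exponent. The homomorphisms are carried along while the generators are adjoined to B one by
  one. Let H be the group generated so far and s the next generator.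

  If some positive power \<open>s ^ m\<close> lies in H, then the m-th powers of the new group lie in H, so that
  composing with the m-th power extends the homomorphisms up to a factor m. If no such power exists,
  then the new group is the direct product of H and the infinite cyclic group of s; the projection to
  H extends the old homomorphisms, and the projection to the exponent of s is a new one.
\<close>

lemma exists_integer_homs:
  assumes B: "subgroup B G" and "finite T" "T \<subseteq> carrier G"
  shows "\<exists>\<Phi> M. finite \<Phi> \<and> 0 < (M::nat) \<and>
    \<Phi> \<subseteq> hom (G\<lparr>carrier := generate G (B \<union> T)\<rparr>) integer_group \<and>
    (\<forall>\<phi>\<in>\<Phi>. \<forall>b\<in>B. \<phi> b = 0) \<and>
    (\<forall>x\<in>generate G (B \<union> T). (\<forall>\<phi>\<in>\<Phi>. \<phi> x = 0) \<longrightarrow> x [^] M \<in> B)"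
  using assms(2,3)
proof (induction T rule: finite_induct)
  case empty
  have "generate G B = B" using B generateI[of B B] by blast
  then show ?case using B by (intro exI[of _ "{}"] exI[of _ 1]) (auto simp: subgroup.mem_carrier)
next
  case (insert s T)
  define H where "H = generate G (B \<union> T)"
  define H' where "H' = generate G (B \<union> insert s T)"
  have Bc: "B \<subseteq> carrier G" using B by (rule subgroup.subset)
  have X: "B \<union> T \<subseteq> carrier G" and s: "s \<in> carrier G" using insert.prems Bc by auto
  have H: "subgroup H G" unfolding H_def using X by (rule generate_is_subgroup)
  have Hc: "H \<subseteq> carrier G" using H by (rule subgroup.subset)
  have BH: "B \<subseteq> H" unfolding H_def by (auto intro: generate.incl)
  have decompose: "\<exists>h\<in>H. \<exists>k::int. x = h \<otimes> s [^] k" if "x \<in> H'" for x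
  proof -
    have "x \<in> generate G (insert s (B \<union> T))" using that by (simp add: H'_def)
    from generate_insert_decompose[OF X s this] show ?thesis unfolding H_def by blast
  qed
  have "\<exists>\<Phi> M. finite \<Phi> \<and> 0 < (M::nat) \<and> \<Phi> \<subseteq> hom (G\<lparr>carrier := H\<rparr>) integer_group \<and>
    (\<forall>\<phi>\<in>\<Phi>. \<forall>b\<in>B. \<phi> b = 0) \<and> (\<forall>x\<in>H. (\<forall>\<phi>\<in>\<Phi>. \<phi> x = 0) \<longrightarrow> x [^] M \<in> B)"
    unfolding H_def using insert.IH insert.prems by simp
  then obtain \<Phi> M where \<Phi>: "finite \<Phi>" "0 < (M::nat)"
    and hom: "\<Phi> \<subseteq> hom (G\<lparr>carrier := H\<rparr>) integer_group"
    and \<Phi>_B: "\<And>\<phi> b. \<phi> \<in> \<Phi> \<Longrightarrow> b \<in> B \<Longrightarrow> \<phi> b = 0"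
    and \<Phi>_ker: "\<And>x. x \<in> H \<Longrightarrow> (\<And>\<phi>. \<phi> \<in> \<Phi> \<Longrightarrow> \<phi> x = 0) \<Longrightarrow> x [^] M \<in> B"
    by (elim exE conjE) simp
  have \<Phi>_mult: "\<phi> (x \<otimes> y) = \<phi> x + \<phi> y" if "\<phi> \<in> \<Phi>" "x \<in> H" "y \<in> H" for \<phi> x y
  proof -
    have "\<phi> \<in> hom (G\<lparr>carrier := H\<rparr>) integer_group" using hom that(1) by blast
    from hom_mult[OF this, of x y] show ?thesis using that by simp
  qed
  have "\<exists>\<Phi>' M'. finite \<Phi>' \<and> 0 < (M'::nat) \<and> \<Phi>' \<subseteq> hom (G\<lparr>carrier := H'\<rparr>) integer_group \<and>
    (\<forall>\<phi>\<in>\<Phi>'. \<forall>b\<in>B. \<phi> b = 0) \<and> (\<forall>x\<in>H'. (\<forall>\<phi>\<in>\<Phi>'. \<phi> x = 0) \<longrightarrow> x [^] M' \<in> B)"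
  proof (cases "\<exists>m::nat. 0 < m \<and> s [^] m \<in> H")
    case True
    then obtain m :: nat where m: "0 < m" "s [^] m \<in> H" by blast
    have pow_H: "x \<in> carrier G \<and> x [^] m \<in> H" if x: "x \<in> H'" for x
    proof -
      obtain h k where h: "h \<in> H" "x = h \<otimes> s [^] (k::int)" using decompose[OF x] by blast
      have hc: "h \<in> carrier G" using h Hc by blast
      have "(s [^] k) [^] m = (s [^] m) [^] k"
        using s by (metis int_pow_int int_pow_pow mult.commute)
      then have "x [^] m = h [^] m \<otimes> (s [^] m) [^] k"
        using h hc s by (simp add: nat_pow_distrib)
      moreover have "h [^] m \<in> H" using subgroup_int_pow_closed[OF H h(1), of "int m"] by (simp add: int_pow_int)
      ultimately show ?thesis using subgroup_int_pow_closed[OF H m(2)] H h hc s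
        by (simp add: subgroup.m_closed)
    qed
    have B_pow: "b [^] m \<in> B" if "b \<in> B" for b
      using subgroup_int_pow_closed[OF B that, of "int m"] by (simp add: int_pow_int)
    show ?thesis
    proof (intro exI conjI ballI impI)
      show "finite ((\<lambda>\<phi> x. \<phi> (x [^] m)) ` \<Phi>)" using \<Phi>(1) by simp
      show "0 < m * M" using m \<Phi> by simp
      show "(\<lambda>\<phi> x. \<phi> (x [^] m)) ` \<Phi> \<subseteq> hom (G\<lparr>carrier := H'\<rparr>) integer_group"
        using pow_H by (auto simp: hom_def nat_pow_distrib \<Phi>_mult)
    next
      fix \<phi> b assume "\<phi> \<in> (\<lambda>\<phi> x. \<phi> (x [^] m)) ` \<Phi>" "b \<in> B"
      then show "\<phi> b = 0" using \<Phi>_B B_pow by auto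
    next
      fix x assume "x \<in> H'" "\<forall>\<phi>\<in>(\<lambda>\<phi> x. \<phi> (x [^] m)) ` \<Phi>. \<phi> x = 0"
      then show "x [^] (m * M) \<in> B" using pow_H \<Phi>_ker[of "x [^] m"] by (auto simp: nat_pow_pow)
    qed
  next
    case False
    have indep: "k = 0" if "s [^] (k::int) \<in> H" for k
    proof (rule ccontr)
      assume "k \<noteq> 0"
      have "s [^] (- k) \<in> H" using subgroup.m_inv_closed[OF H that] s by (simp add: int_pow_neg)
      then have "s [^] (int (nat \<bar>k\<bar>)) \<in> H" using that by (cases "0 \<le> k") auto
      then have "s [^] nat \<bar>k\<bar> \<in> H" by (simp only: int_pow_int)
      moreover have "0 < nat \<bar>k\<bar>" using \<open>k \<noteq> 0\<close> by simp
      ultimately have "\<exists>m::nat. 0 < m \<and> s [^] m \<in> H" by (intro exI conjI)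
      with False show False by contradiction
    qed
    \<comment> \<open>The two projections of the direct product: the exponent of s and the component in H.\<close>
    define \<kappa> where "\<kappa> x = (SOME k::int. \<exists>h\<in>H. x = h \<otimes> s [^] k)" for x
    define \<rho> where "\<rho> x = x \<otimes> s [^] (- \<kappa> x)" for x
    have \<kappa>: "\<kappa> (h \<otimes> s [^] k) = k" if h: "h \<in> H" for h and k :: int
      unfolding \<kappa>_def
    proof (rule some_equality)
      show "\<exists>h'\<in>H. h \<otimes> s [^] k = h' \<otimes> s [^] k" using h by blast
    next
      fix l :: int assume "\<exists>h'\<in>H. h \<otimes> s [^] k = h' \<otimes> s [^] l"
      then obtain h' where h': "h' \<in> H" "h \<otimes> s [^] k = h' \<otimes> s [^] l" by blast
      have c: "h \<in> carrier G" "h' \<in> carrier G" using h h' Hc by auto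
      have "s [^] (l - k) = inv h' \<otimes> (h' \<otimes> s [^] l) \<otimes> inv (s [^] k)"
        using c s by (simp add: int_pow_diff m_assoc[symmetric])
      also have "\<dots> = inv h' \<otimes> h"
        unfolding h'(2)[symmetric] using c s by (simp add: m_assoc)
      also have "\<dots> \<in> H" using h h' H by (simp add: subgroup.m_closed subgroup.m_inv_closed)
      finally have "l - k = 0" by (rule indep)
      then show "l = k" by simp
    qed
    have \<rho>: "\<rho> (h \<otimes> s [^] k) = h" if h: "h \<in> H" for h and k :: int
    proof -
      have "h \<in> carrier G" using h Hc by (rule rev_subsetD)
      then have "h \<otimes> s [^] k \<otimes> s [^] (- k) = h"
        using s int_pow_mult[of s k "- k"] by (simp add: m_assoc)
      then show ?thesis unfolding \<rho>_def \<kappa>[OF h] .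
    qed
    have mult: "\<kappa> (x \<otimes> y) = \<kappa> x + \<kappa> y \<and> \<rho> (x \<otimes> y) = \<rho> x \<otimes> \<rho> y \<and> \<rho> x \<in> H \<and> \<rho> y \<in> H"
      if xy: "x \<in> H'" "y \<in> H'" for x y
    proof -
      obtain h k h' k' where *: "h \<in> H" "x = h \<otimes> s [^] (k::int)" "h' \<in> H" "y = h' \<otimes> s [^] (k'::int)"
        using decompose[OF xy(1)] decompose[OF xy(2)] by (elim bexE exE)
      have c: "h \<in> carrier G" "h' \<in> carrier G" using * Hc by auto
      have "x \<otimes> y = (h \<otimes> h') \<otimes> s [^] (k + k')" using * c s by (simp add: int_pow_mult m_ac)
      moreover have "h \<otimes> h' \<in> H" using * H by (simp add: subgroup.m_closed)
      ultimately show ?thesis using * by (simp add: \<kappa> \<rho>)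
    qed
    have on_H: "\<kappa> h = 0 \<and> \<rho> h = h" if "h \<in> H" for h
      using \<kappa>[OF that, of 0] \<rho>[OF that, of 0] that Hc by auto
    show ?thesis
    proof (intro exI conjI ballI impI)
      show "finite (insert \<kappa> ((\<lambda>\<phi> x. \<phi> (\<rho> x)) ` \<Phi>))" using \<Phi>(1) by simp
      show "0 < M" by (rule \<Phi>(2))
      show "insert \<kappa> ((\<lambda>\<phi> x. \<phi> (\<rho> x)) ` \<Phi>) \<subseteq> hom (G\<lparr>carrier := H'\<rparr>) integer_group"
        using mult by (auto simp: hom_def \<Phi>_mult)
    next
      fix \<phi> b assume "\<phi> \<in> insert \<kappa> ((\<lambda>\<phi> x. \<phi> (\<rho> x)) ` \<Phi>)" "b \<in> B"
      then show "\<phi> b = 0" using \<Phi>_B on_H BH by auto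
    next
      fix x assume x: "x \<in> H'" "\<forall>\<phi>\<in>insert \<kappa> ((\<lambda>\<phi> x. \<phi> (\<rho> x)) ` \<Phi>). \<phi> x = 0"
      obtain h k where h: "h \<in> H" "x = h \<otimes> s [^] (k::int)" using decompose[OF x(1)] by blast
      then have "x = h" using x(2) \<kappa> Hc by auto
      then show "x [^] M \<in> B" using x(2) h(1) on_H by (intro \<Phi>_ker) auto
    qed
  qed
  then show ?case unfolding H'_def .
qed

section \<open>Word length\<close>

lemma word_exists:
  assumes S: "S \<subseteq> carrier G" and g: "g \<in> generate G S"
  shows "\<exists>w. set w \<subseteq> S \<union> m_inv G ` S \<and> foldr (\<otimes>) w \<one> = g"
  using g
proof (induction rule: generate.induct)
  case one
  show ?case by (rule exI[of _ "[]"]) simp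
next
  case (incl h)
  then show ?case using S by (intro exI[of _ "[h]"]) auto
next
  case (inv h)
  then show ?case using S by (intro exI[of _ "[inv h]"]) auto
next
  case (eng g h)
  then obtain v w where *: "set v \<subseteq> S \<union> m_inv G ` S" "foldr (\<otimes>) v \<one> = g"
    "set w \<subseteq> S \<union> m_inv G ` S" "foldr (\<otimes>) w \<one> = h" by blast
  have h: "h \<in> carrier G" using eng S generate_in_carrier by blast
  have v: "set v \<subseteq> carrier G" using *(1) S by auto
  have closed: "set u \<subseteq> carrier G \<Longrightarrow> foldr (\<otimes>) u \<one> \<in> carrier G" for u
    by (induction u) auto
  have "set v \<subseteq> carrier G \<Longrightarrow> foldr (\<otimes>) v h = foldr (\<otimes>) v \<one> \<otimes> h"
    using h closed by (induction v) (auto simp: m_assoc)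
  then show ?case using * v by (intro exI[of _ "v @ w"]) auto
qed

lemma word_length_attained:
  assumes "finite_generating_set G S" "g \<in> carrier G"
  obtains w where "set w \<subseteq> S \<union> m_inv G ` S" "length w = word_length G S g" "foldr (\<otimes>) w \<one> = g"
proof -
  obtain v where "set v \<subseteq> S \<union> m_inv G ` S" "foldr (\<otimes>) v \<one> = g"
    using word_exists[of S g] assms unfolding finite_generating_set_def by auto
  then have "\<exists>n w. set w \<subseteq> S \<union> m_inv G ` S \<and> length w = n \<and> foldr (\<otimes>) w \<one> = g" by blast
  from LeastI_ex[OF this] show thesis using that unfolding word_length_def by blast
qed

lemma word_length_pow_le:
  assumes "s \<in> S" "s \<in> carrier G"
  shows "word_length G S (s [^] (n::nat)) \<le> n"
  unfolding word_length_def
proof (rule Least_le, intro exI conjI)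
  show "set (replicate n s) \<subseteq> S \<union> m_inv G ` S" using assms by auto
  have "foldr (\<otimes>) (replicate n s) \<one> = s [^] n"
  proof (induction n)
    case (Suc n)
    then show ?case using assms(2) nat_pow_Suc2[of s n] by simp
  qed simp
  then show "foldr (\<otimes>) (replicate n s) \<one> = s [^] n" .
qed simp

text \<open>
  Homomorphisms to the integers are Lipschitz for the word length. This is what turns the bound on the
  length of an element into a bound on the integers that have to be shown nonzero modulo some q.
\<close>

lemma integer_hom_le_word_length:
  assumes S: "finite_generating_set G S" and \<phi>: "\<phi> \<in> hom G integer_group"
    and K: "\<And>s. s \<in> S \<Longrightarrow> \<bar>\<phi> s\<bar> \<le> int K" and g: "g \<in> carrier G"
  shows "\<bar>\<phi> g\<bar> \<le> int (K * word_length G S g)"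
proof -
  obtain w where w: "set w \<subseteq> S \<union> m_inv G ` S" "length w = word_length G S g" "foldr (\<otimes>) w \<one> = g"
    using word_length_attained[OF S g] .
  interpret \<phi>: group_hom G integer_group \<phi>
    using \<phi> by (intro group_hom.intro group_hom_axioms.intro) (auto simp: is_group)
  have Sc: "S \<subseteq> carrier G" using S by (simp add: finite_generating_set_def)
  have "foldr (\<otimes>) w \<one> \<in> carrier G \<and> \<bar>\<phi> (foldr (\<otimes>) w \<one>)\<bar> \<le> int (K * length w)" using w(1)
  proof (induction w)
    case Nil
    then show ?case by simp
  next
    case (Cons a w)
    have a: "a \<in> carrier G" "\<bar>\<phi> a\<bar> \<le> int K" using Cons.prems Sc K by auto
    moreover have "\<bar>\<phi> (a \<otimes> foldr (\<otimes>) w \<one>)\<bar> \<le> \<bar>\<phi> a\<bar> + \<bar>\<phi> (foldr (\<otimes>) w \<one>)\<bar>"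
      using Cons a by simp
    ultimately show ?case using Cons by (auto simp: algebra_simps)
  qed
  then show ?thesis using w by simp
qed

section \<open>Separation by finite quotients\<close>

text \<open>
  The product of B with the group of M-th powers has finite index, so that a single finite quotient
  separates from B everything outside this product.
\<close>

lemma sep_depth_power_coset:
  assumes S: "finite_generating_set G S" and B: "subgroup B G" and M: "0 < (M::nat)"
  shows "\<exists>D. \<forall>g\<in>carrier G - ((\<lambda>a. a [^] M) ` carrier G <#> B). sep_depth G B g \<le> enat D"
proof -
  define K where "K = (\<lambda>a. a [^] M) ` carrier G <#> B"
  have Bc: "b \<in> carrier G" if "b \<in> B" for b using B that by (rule subgroup.mem_carrier)
  have mem: "a [^] M \<otimes> b \<in> K" if "a \<in> carrier G" "b \<in> B" for a b
    using that unfolding K_def set_mult_def by blast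
  have K: "subgroup K G"
  proof (rule subgroupI)
    show "K \<subseteq> carrier G" using Bc by (auto simp: K_def set_mult_def)
    show "K \<noteq> {}" using mem[of \<one> \<one>] B by (auto simp: subgroup.one_closed)
  next
    fix x assume "x \<in> K"
    then obtain a b where ab: "a \<in> carrier G" "b \<in> B" "x = a [^] M \<otimes> b" by (auto simp: K_def set_mult_def)
    then have "inv x = (inv a) [^] M \<otimes> inv b"
      using Bc by (simp add: inv_mult nat_pow_inv)
    then show "inv x \<in> K" using mem[of "inv a" "inv b"] ab B by (simp add: subgroup.m_inv_closed)
    fix y assume "y \<in> K"
    then obtain c d where cd: "c \<in> carrier G" "d \<in> B" "y = c [^] M \<otimes> d" by (auto simp: K_def set_mult_def)
    have "x \<otimes> y = (a \<otimes> c) [^] M \<otimes> (b \<otimes> d)"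
      using ab cd Bc by (simp add: nat_pow_distrib m_ac)
    then show "x \<otimes> y \<in> K" using mem[of "a \<otimes> c" "b \<otimes> d"] ab cd B by (simp add: subgroup.m_closed)
  qed
  interpret K: normal K G using K by (rule subgroup_imp_normal)
  have BK: "B \<subseteq> K" using mem[of \<one>] Bc by fastforce
  have gen: "generate G (K \<union> S) = carrier G"
    using S mono_generate[of S "K \<union> S"] generate_incl[of "K \<union> S"] K.subset
    unfolding finite_generating_set_def by auto
  have "finite ((#>) K ` generate G (K \<union> S))"
    using S mem[of _ \<one>] subgroup.one_closed[OF B]
    by (intro finite_rcosets_if_torsion_generators[OF K _ _ M]) (auto simp: finite_generating_set_def subset_iff)
  moreover have "carrier (G Mod K) = (#>) K ` carrier G"
    by (auto simp: FactGroup_def RCOSETS_def)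
  ultimately have fin: "finite (carrier (G Mod K))" unfolding gen by simp
  show ?thesis
  proof (intro exI ballI)
    fix g assume "g \<in> carrier G - ((\<lambda>a. a [^] M) ` carrier G <#> B)"
    then have g: "g \<in> carrier G" "g \<notin> K" by (simp_all add: K_def)
    show "sep_depth G B g \<le> enat (order (G Mod K))"
    proof (rule sep_depth_le[OF K.factorgroup_is_group fin K.r_coset_hom_Mod])
      show "K #> g \<notin> (#>) K ` B"
      proof
        assume "K #> g \<in> (#>) K ` B"
        then obtain b where b: "b \<in> B" "K #> g = K #> b" by blast
        then have "K #> g = K" using BK K by (metis coset_join2 subgroup.mem_carrier subset_iff)
        then show False using g K coset_join1 K.subset by blast
      qed
    qed (use g Bc in auto)
  qed
qed

lemma sep_depth_integer_hom:
  assumes B: "B \<subseteq> carrier G" and g: "g \<in> carrier G" and \<phi>: "\<phi> \<in> hom G integer_group"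
    and zero: "\<And>b. b \<in> B \<Longrightarrow> \<phi> b = 0" and q: "0 < q" "\<not> int q dvd \<phi> g"
  shows "sep_depth G B g \<le> enat q"
proof -
  have "sep_depth G B g \<le> enat (order (integer_mod_group q))"
  proof (rule sep_depth_le[where p = "\<lambda>x. \<phi> x mod int q"])
    show "(\<lambda>x. \<phi> x mod int q) \<in> hom G (integer_mod_group q)"
      using \<phi> q(1) by (auto simp: hom_def carrier_integer_mod_group mod_add_eq)
    show "\<phi> g mod int q \<notin> (\<lambda>x. \<phi> x mod int q) ` B"
      using zero q(2) by (auto simp: dvd_eq_mod_eq_0)
  qed (use q(1) B g in \<open>auto simp: carrier_integer_mod_group\<close>)
  also have "order (integer_mod_group q) = q"
    using q(1) by (simp add: order_def carrier_integer_mod_group)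
  finally show ?thesis .
qed

text \<open>
  Take finitely many homomorphisms to the integers and an exponent M as provided by
  \<open>exists_integer_homs\<close>. If one of the homomorphisms does not vanish at g, then its value is bounded
  linearly by the length of g, and reducing it modulo a small nondivisor gives a cyclic quotient that
  separates g. Otherwise g cannot be of the form \<open>a ^ M * b\<close> with b in B: the homomorphisms would
  vanish at a as well, so \<open>a ^ M\<close> and then g would be in B. Hence g is separated by the fixed finite
  quotient by M-th powers, whose order D does not depend on g.
\<close>

lemma sep_depth_upper_bound:
  assumes S: "finite_generating_set G S" and B: "subgroup B G"
  shows "\<exists>D K. \<forall>g\<in>carrier G - B. \<forall>m. K * word_length G S g < 2 ^ m \<longrightarrow>
    sep_depth G B g \<le> enat (max D (Suc m))"
proof -
  have Sc: "finite S" "S \<subseteq> carrier G" "generate G S = carrier G"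
    using S by (auto simp: finite_generating_set_def)
  have Bc: "B \<subseteq> carrier G" using B by (rule subgroup.subset)
  have gen: "generate G (B \<union> S) = carrier G"
    using Sc mono_generate[of S "B \<union> S"] generate_incl[of "B \<union> S"] Bc by auto
  have "\<exists>\<Phi> M. finite \<Phi> \<and> 0 < (M::nat) \<and> \<Phi> \<subseteq> hom G integer_group \<and>
    (\<forall>\<phi>\<in>\<Phi>. \<forall>b\<in>B. \<phi> b = 0) \<and> (\<forall>x\<in>carrier G. (\<forall>\<phi>\<in>\<Phi>. \<phi> x = 0) \<longrightarrow> x [^] M \<in> B)"
    using exists_integer_homs[OF B Sc(1,2)] unfolding gen by simp
  then obtain \<Phi> M where \<Phi>: "finite \<Phi>" "0 < (M::nat)" "\<Phi> \<subseteq> hom G integer_group"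
    "\<And>\<phi> b. \<phi> \<in> \<Phi> \<Longrightarrow> b \<in> B \<Longrightarrow> \<phi> b = 0"
    "\<And>x. x \<in> carrier G \<Longrightarrow> (\<And>\<phi>. \<phi> \<in> \<Phi> \<Longrightarrow> \<phi> x = 0) \<Longrightarrow> x [^] M \<in> B"
    by (elim exE conjE) simp
  define K where "K = Max (insert 0 ((\<lambda>(\<phi>, s). nat \<bar>\<phi> s\<bar>) ` (\<Phi> \<times> S)))"
  have K: "\<bar>\<phi> s\<bar> \<le> int K" if "\<phi> \<in> \<Phi>" "s \<in> S" for \<phi> s
  proof -
    have "nat \<bar>\<phi> s\<bar> \<le> K" unfolding K_def using that \<Phi>(1) Sc(1) by (intro Max_ge) auto
    then show ?thesis by linarith
  qed
  obtain D where D: "\<forall>g\<in>carrier G - ((\<lambda>a. a [^] M) ` carrier G <#> B). sep_depth G B g \<le> enat D"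
    using sep_depth_power_coset[OF S B \<Phi>(2)] by (elim exE)
  show ?thesis
  proof (intro exI ballI allI impI)
    fix g m assume g: "g \<in> carrier G - B" and m: "K * word_length G S g < 2 ^ m"
    show "sep_depth G B g \<le> enat (max D (Suc m))"
    proof (cases "\<exists>\<phi>\<in>\<Phi>. \<phi> g \<noteq> 0")
      case True
      then obtain \<phi> where \<phi>: "\<phi> \<in> \<Phi>" "\<phi> g \<noteq> 0" by blast
      then have hom: "\<phi> \<in> hom G integer_group" using \<Phi>(3) by blast
      have "\<bar>\<phi> g\<bar> \<le> int (K * word_length G S g)"
        using integer_hom_le_word_length[OF S hom] K[OF \<phi>(1)] g by blast
      also have "\<dots> < int (2 ^ m)" using m by (simp only: of_nat_less_iff)
      finally have "\<bar>\<phi> g\<bar> < 2 ^ m" by simp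
      then obtain q where q: "0 < q" "q \<le> Suc m" "\<not> int q dvd \<phi> g"
        by (rule small_nondivisor[OF \<phi>(2)])
      have "sep_depth G B g \<le> enat q"
        using sep_depth_integer_hom[OF Bc _ hom \<Phi>(4)[OF \<phi>(1)] q(1,3)] g by blast
      also have "\<dots> \<le> enat (max D (Suc m))" using q(2) by simp
      finally show ?thesis .
    next
      case False
      have "g \<noteq> a [^] M \<otimes> b" if a: "a \<in> carrier G" and b: "b \<in> B" for a b
      proof
        assume eq: "g = a [^] M \<otimes> b"
        have "\<phi> a = 0" if "\<phi> \<in> \<Phi>" for \<phi>
        proof -
          interpret \<phi>: group_hom G integer_group \<phi>
            using \<Phi>(3) that by (intro group_hom.intro group_hom_axioms.intro) (auto simp: is_group)
          have "\<phi> g = int M * \<phi> a"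
            using eq a b Bc \<Phi>(4)[OF that b] by (auto simp: \<phi>.hom_nat_pow subset_iff)
          then show ?thesis using False that \<Phi>(2) by auto
        qed
        then have "a [^] M \<in> B" using \<Phi>(5)[OF a] by blast
        then show False using eq b B g by (auto simp: subgroup.m_closed)
      qed
      then have "g \<in> carrier G - ((\<lambda>a. a [^] M) ` carrier G <#> B)"
        using g by (auto simp: set_mult_def)
      then have "sep_depth G B g \<le> enat D" by (rule D[rule_format])
      also have "\<dots> \<le> enat (max D (Suc m))" by simp
      finally show ?thesis .
    qed
  qed
qed

text \<open>
  A finite group of order at most m has exponent dividing \<open>Lcm {1..m}\<close>, so in every such quotient the
  given power becomes trivial and falls into the image of B.
\<close>

lemma sep_depth_lcm_power:
  assumes B: "subgroup B G" and s: "s \<in> carrier G"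
  shows "enat (Suc m) \<le> sep_depth G B (s [^] Lcm {1..m})"
  unfolding sep_depth_def
proof (rule INF_greatest)
  fix Q :: "nat monoid"
  assume "Q \<in> {Q. group Q \<and> finite (carrier Q) \<and> (\<exists>\<pi>\<in>hom G Q. \<pi> (s [^] Lcm {1..m}) \<notin> \<pi> ` B)}"
  then obtain \<pi> where Q: "group Q" "finite (carrier Q)" and \<pi>: "\<pi> \<in> hom G Q"
    and ne: "\<pi> (s [^] Lcm {1..m}) \<notin> \<pi> ` B" by auto
  interpret \<pi>: group_hom G Q \<pi>
    using \<pi> Q by (intro group_hom.intro group_hom_axioms.intro) (auto simp: is_group)
  have "\<not> order Q \<le> m"
  proof
    assume "order Q \<le> m"
    moreover have "0 < order Q" using Q(2) \<pi>.H.order_gt_0_iff_finite by blast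
    ultimately have "order Q dvd Lcm {1..m}" by (intro dvd_Lcm) auto
    then obtain c where c: "Lcm {1..m} = order Q * c" by blast
    have "\<pi> (s [^] Lcm {1..m}) = (\<pi> s [^]\<^bsub>Q\<^esub> order Q) [^]\<^bsub>Q\<^esub> c"
      unfolding c using s by (simp add: \<pi>.hom_nat_pow \<pi>.H.nat_pow_pow)
    also have "\<dots> = \<pi> \<one>" using s by (simp add: \<pi>.H.pow_order_eq_1)
    finally show False using ne subgroup.one_closed[OF B] by blast
  qed
  then show "enat (Suc m) \<le> enat (order Q)" by simp
qed

text \<open>
  If all generators were torsion modulo B, then B would have finite index.
\<close>

lemma infinite_order_generator:
  assumes S: "finite_generating_set G S" and B: "subgroup B G" and inf: "infinite (rcosets B)"
  obtains s where "s \<in> S" "\<And>n::nat. 0 < n \<Longrightarrow> s [^] n \<notin> B"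
proof -
  have Sc: "finite S" "S \<subseteq> carrier G" "generate G S = carrier G"
    using S by (auto simp: finite_generating_set_def)
  have "\<exists>s\<in>S. \<forall>n::nat. 0 < n \<longrightarrow> s [^] n \<notin> B"
  proof (rule ccontr)
    assume "\<not> ?thesis"
    then obtain f :: "'a \<Rightarrow> nat" where f: "\<And>s. s \<in> S \<Longrightarrow> 0 < f s \<and> s [^] f s \<in> B" by metis
    have pow: "s [^] (\<Prod>s\<in>S. f s) \<in> B" if "s \<in> S" for s
    proof -
      have "f s dvd (\<Prod>s\<in>S. f s)" using that Sc(1) by (rule dvd_prodI[rotated])
      then obtain c where "(\<Prod>s\<in>S. f s) = f s * c" by blast
      then have "s [^] (\<Prod>s\<in>S. f s) = (s [^] f s) [^] int c"
        using that Sc(2) by (auto simp: nat_pow_pow int_pow_int subset_iff)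
      then show ?thesis using subgroup_int_pow_closed[OF B] f[OF that] by metis
    qed
    have "generate G (B \<union> S) = carrier G"
      using Sc mono_generate[of S "B \<union> S"] generate_incl[of "B \<union> S"] subgroup.subset[OF B] by auto
    moreover have "finite ((#>) B ` generate G (B \<union> S))"
      using f pow by (intro finite_rcosets_if_torsion_generators[OF B Sc(1,2), of "\<Prod>s\<in>S. f s"]) (auto simp: prod_pos)
    moreover have "rcosets B = (#>) B ` carrier G" by (auto simp: RCOSETS_def)
    ultimately show False using inf by simp
  qed
  then show thesis using that by blast
qed

end

section \<open>Logarithmic growth\<close>

text \<open>
  The smallest admissible m is about \<open>log 2 (K * n)\<close>, so f is at most \<open>D + O(1) + 2 * ln (K * n)\<close>.
  The additive constants are absorbed because the relation allows n to be rescaled: \<open>ln (C * n)\<close> is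
  at least 1 as soon as \<open>C \<ge> 4\<close>.
\<close>

lemma growth_le_ln_if_power_of_two_bound:
  fixes f :: "nat \<Rightarrow> enat"
  assumes f: "\<And>n m. 0 < n \<Longrightarrow> K * n < 2 ^ m \<Longrightarrow> f n \<le> enat (max D (Suc m))"
  shows "(\<lambda>n. ereal_of_enat (f n)) \<lesssim>g (\<lambda>n. ereal (ln (real n)))"
  unfolding growth_le_def
proof (intro exI conjI allI impI)
  define C where "C = K + D + 4"
  show "0 < C" by (simp add: C_def)
  fix n :: nat assume n: "0 < n"
  \<comment> \<open>The successor keeps the argument of the logarithm positive if K is 0.\<close>
  define x where "x = real (Suc K * n)"
  have x: "1 \<le> x" using n by (simp add: x_def Suc_le_eq del: of_nat_mult of_nat_Suc)
  define m where "m = Suc (nat \<lfloor>log 2 x\<rfloor>)"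
  have log_nonneg: "0 \<le> log 2 x" using x by simp
  have "log 2 x < real m" unfolding m_def using log_nonneg by linarith
  then have "x < 2 powr real m" using x by (simp add: log_less_iff)
  then have "x < real (2 ^ m)" by (simp add: powr_realpow)
  then have "Suc K * n < 2 ^ m" unfolding x_def by (simp only: of_nat_less_iff)
  then have "K * n < 2 ^ m" by simp
  from f[OF n this] have le: "f n \<le> enat (max D (Suc m))" .
  have xC: "x \<le> real (C * n)" "4 \<le> real (C * n)"
  proof -
    show "x \<le> real (C * n)" unfolding x_def C_def of_nat_le_iff by (intro mult_right_mono) auto
    have "4 * 1 \<le> C * n" using n unfolding C_def by (intro mult_mono) auto
    then show "4 \<le> real (C * n)" by linarith
  qed
  have ln2: "1 / 2 \<le> ln (2::real)"
    using ln_le_minus_one[of "1 / 2 :: real"] by (simp add: ln_div)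
  have ln4: "1 \<le> ln (4::real)"
  proof -
    have "ln (4::real) = ln (2 ^ 2)" by simp
    also have "\<dots> = 2 * ln 2" by (subst ln_realpow) simp_all
    finally show ?thesis using ln2 by linarith
  qed
  have lnC: "1 \<le> ln (real (C * n))" using ln4 xC(2) ln_le_cancel_iff[of 4 "real (C * n)"] by linarith
  have lnx: "ln x \<le> ln (real (C * n))" using x xC(1) by simp
  have "log 2 x \<le> 2 * ln x"
  proof -
    have "ln x * 1 \<le> ln x * (2 * ln 2)" using x ln2 by (intro mult_left_mono) auto
    then show ?thesis unfolding log_def by (simp add: divide_le_eq mult.commute mult.left_commute)
  qed
  moreover have "real m \<le> 1 + log 2 x" unfolding m_def using log_nonneg by linarith
  ultimately have "real (max D (Suc m)) \<le> (real D + 2) * 1 + 2 * ln (real (C * n))"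
    using lnx by (simp add: max_def)
  also have "\<dots> \<le> (real D + 2) * ln (real (C * n)) + 2 * ln (real (C * n))"
    using lnC by (intro add_right_mono mult_left_mono) auto
  also have "\<dots> = (real D + 4) * ln (real (C * n))" by (simp only: algebra_simps)
  also have "\<dots> \<le> real C * ln (real (C * n))"
    using lnC unfolding C_def by (intro mult_right_mono) auto
  finally have bound: "real (max D (Suc m)) \<le> real C * ln (real (C * n))" .
  have "ereal_of_enat (f n) \<le> ereal_of_enat (enat (max D (Suc m)))"
    using le by (simp only: ereal_of_enat_le_iff)
  also have "\<dots> = ereal (real (max D (Suc m)))" by (simp only: ereal_of_enat_simps)
  also have "\<dots> \<le> ereal (real C * ln (real (C * n)))" using bound by (simp only: ereal_less_eq)
  also have "\<dots> = ereal (real C) * ereal (ln (real (C * n)))" by simp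
  finally show "ereal_of_enat (f n) \<le> ereal (real C) * ereal (ln (real (C * n)))" .
qed

text \<open>
  The constant 4 bounds \<open>ln 16\<close>, and \<open>log 16 n\<close> is at most \<open>Suc m\<close> for the largest admissible m.
\<close>

lemma ln_growth_le_if_power_of_16_bound:
  fixes f :: "nat \<Rightarrow> enat"
  assumes f: "\<And>n m. 16 ^ m \<le> n \<Longrightarrow> enat (Suc m) \<le> f n"
  shows "(\<lambda>n. ereal (ln (real n))) \<lesssim>g (\<lambda>n. ereal_of_enat (f n))"
  unfolding growth_le_def
proof (intro exI conjI allI impI)
  show "0 < (4::nat)" by simp
  fix n :: nat assume n: "0 < n"
  define m where "m = nat \<lfloor>log 16 (real n)\<rfloor>"
  have log_nonneg: "0 \<le> log 16 (real n)" using n by simp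
  have "real m \<le> log 16 (real n)" unfolding m_def using log_nonneg by linarith
  then have "16 powr real m \<le> real n" using n by (simp add: le_log_iff)
  then have "real (16 ^ m) \<le> real n" by (simp add: powr_realpow)
  then have "16 ^ m \<le> 4 * n" by linarith
  from f[OF this] have le: "enat (Suc m) \<le> f (4 * n)" .
  have "ln (16::real) = ln (2 ^ 4)" by simp
  also have "\<dots> = 4 * ln 2" by (subst ln_realpow) simp_all
  also have "\<dots> \<le> 4" using ln_le_minus_one[of "2::real"] by simp
  finally have ln16: "ln (16::real) \<le> 4" .
  have "log 16 (real n) \<le> real (Suc m)" unfolding m_def using log_nonneg by linarith
  have "ln (real n) = ln 16 * log 16 (real n)" by (simp add: log_def)
  also have "\<dots> \<le> 4 * real (Suc m)"
    using ln16 log_nonneg \<open>log 16 (real n) \<le> real (Suc m)\<close> by (intro mult_mono) auto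
  finally have "ereal (ln (real n)) \<le> ereal (real 4) * ereal (real (Suc m))"
    by (simp only: times_ereal.simps ereal_less_eq of_nat_numeral)
  also have "\<dots> = ereal (real 4) * ereal_of_enat (enat (Suc m))" by (simp only: ereal_of_enat_simps)
  also have "\<dots> \<le> ereal (real 4) * ereal_of_enat (f (4 * n))"
    using le by (intro ereal_mult_left_mono) (simp_all only: ereal_of_enat_le_iff, simp)
  finally show "ereal (ln (real n)) \<le> ereal (real 4) * ereal_of_enat (f (4 * n))" .
qed

theorem corollary1p2:
  fixes A :: "('a, 'b) monoid_scheme" and B S :: "'a set"
  assumes "comm_group A"
    and "torsion_free_group A"
    and "finite_generating_set A S"
    and "subgroup B A"
    and "infinite (rcosets\<^bsub>A\<^esub> B)"
  shows "(\<lambda>n. ereal_of_enat (sep_growth A B S n)) \<approx>g (\<lambda>n. ereal (ln (real n)))"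
  unfolding growth_equiv_def
proof
  interpret comm_group A by fact
  obtain D K where DK: "\<forall>g\<in>carrier A - B. \<forall>m. K * word_length A S g < 2 ^ m \<longrightarrow>
    sep_depth A B g \<le> enat (max D (Suc m))"
    using sep_depth_upper_bound[OF assms(3,4)] by (elim exE)
  show "(\<lambda>n. ereal_of_enat (sep_growth A B S n)) \<lesssim>g (\<lambda>n. ereal (ln (real n)))"
  proof (rule growth_le_ln_if_power_of_two_bound)
    fix n m :: nat assume n: "K * n < 2 ^ m"
    show "sep_growth A B S n \<le> enat (max D (Suc m))"
      unfolding sep_growth_def
    proof (rule SUP_least)
      fix g assume g: "g \<in> {g \<in> carrier A - B. word_length A S g \<le> n}"
      then have "K * word_length A S g \<le> K * n" by simp
      then have "K * word_length A S g < 2 ^ m" using n by (rule le_less_trans)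
      then show "sep_depth A B g \<le> enat (max D (Suc m))" using DK g by simp
    qed
  qed
  obtain s where s: "s \<in> S" "\<And>n::nat. 0 < n \<Longrightarrow> s [^]\<^bsub>A\<^esub> n \<notin> B"
    using infinite_order_generator[OF assms(3-5)] by metis
  have sc: "s \<in> carrier A" using assms(3) s(1) by (auto simp: finite_generating_set_def)
  show "(\<lambda>n. ereal (ln (real n))) \<lesssim>g (\<lambda>n. ereal_of_enat (sep_growth A B S n))"
  proof (rule ln_growth_le_if_power_of_16_bound)
    fix n m :: nat assume "16 ^ m \<le> n"
    then have "Lcm {1..m} \<le> n" using Lcm_upper_bound le_trans by blast
    then have "word_length A S (s [^]\<^bsub>A\<^esub> Lcm {1..m}) \<le> n"
      using word_length_pow_le[OF s(1) sc] le_trans by blast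
    moreover have "s [^]\<^bsub>A\<^esub> Lcm {1..m} \<in> carrier A - B"
      using sc s(2)[OF Lcm_atLeastAtMost_pos] by blast
    ultimately have "sep_depth A B (s [^]\<^bsub>A\<^esub> Lcm {1..m}) \<le> sep_growth A B S n"
      unfolding sep_growth_def by (intro SUP_upper CollectI conjI)
    with sep_depth_lcm_power[OF assms(4) sc] show "enat (Suc m) \<le> sep_growth A B S n"
      by (rule order_trans)
  qed
qed

end
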